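(* Let $q$ be a prime power, $m\ge1$, and regard $\mathbb F_{q^m}$ as an $m$-dimensional $\mathbb F_q$-vector space. Let $Q$ be a quadratic form on $\mathbb F_{q^m}$ and $S$ a symmetric bilinear form on $\mathbb F_{q^m}$ (over $\mathbb F_q$). (1) If $m=2n-1$ is odd, there exist unique $f_0,\dots,f_{n-1}\in\mathbb F_{q^m}$ and unique $g_0,\dots,g_{n-1}\in\mathbb F_{q^m}$ such that \[ Q(x)=\sum_{i=0}^{n-1}\mathrm{Tr}_m(f_ix^{q^i+1}),\qquad S(x,y)=\mathrm{Tr}_m(g_0xy)+\sum_{i=1}^{n-1}\mathrm{Tr}_m\big(g_i(xy^{q^i}+x^{q^i}y)\big). \] Moreover, there are $\mathbb F_q$-bases of $\mathbb F_{q^m}$ such that, with respect to these bases, $\langle Q,S\rangle=\chi\big(\sum_{i=0}^{n-1}\mathrm{Tr}_m(f_ig_i)\big)$ for all $Q,S$. (2) If $m=2n$ is even, there exist unique $f_0,\dots,f_{n-1},g_0,\dots,g_{n-1}\in\mathbb F_{q^m}$ and $f_n,g_n\in\mathbb F_{q^n}$ such that \[ Q(x)=\sum_{i=0}^{n-1}\mathrm{Tr}_m(f_ix^{q^i+1})+\mathrm{Tr}_n(f_nx^{q^n+1}), \] \[ S(x,y)=\mathrm{Tr}_m(g_0xy)+\sum_{i=1}^{n-1}\mathrm{Tr}_m\big(g_i(xy^{q^i}+x^{q^i}y)\big)+\mathrm{Tr}_m(g_nxy^{q^n}). \] Moreover, there are $\mathbb F_q$-bases of $\mathbb F_{q^m}$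 such that, with respect to these bases, $\langle Q,S\rangle=\chi\big(\sum_{i=0}^{n-1}\mathrm{Tr}_m(f_ig_i)+\mathrm{Tr}_n(f_ng_n)\big)$ for all $Q,S$.
   Context: For a positive integer $k$, $\mathrm{Tr}_k:\mathbb F_{q^k}\to\mathbb F_q$ is the relative trace $\mathrm{Tr}_k(y)=\sum_{i=1}^k y^{q^i}$. Fix a nontrivial character $\chi$ of $(\mathbb F_q,+)$. The pairing with respect to a pair of $\mathbb F_q$-bases $(u_1,\dots,u_m)$ (for quadratic forms) and $(w_1,\dots,w_m)$ (for symmetric bilinear forms) of $\mathbb F_{q^m}$ is defined as follows: choose $A\in\mathbb F_q^{m\times m}$ with $Q(\sum_ix_iu_i)=\sum_{i,j}A_{ij}x_ix_j$ for all $(x_1,\dots,x_m)\in\mathbb F_q^m$ ($A$ is unique up to adding an alternating matrix), let $B_{ij}=S(w_i,w_j)$, and set $\langle Q,S\rangle=\chi(\operatorname{tr}(AB))$ (this is well defined since $\operatorname{tr}(CD)=0$ for $C$ alternating and $D$ symmetric). *)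

theory Defs
  imports "HOL-Analysis.Analysis"
begin

text \<open>The field with \<open>q\<close> elements is a finite field type \<open>'q\<close>, so that \<open>q = CARD('q)\<close>, and its
  extension is a finite field type \<open>'a\<close> together with an embedding \<open>\<iota>\<close> of \<open>'q\<close> into \<open>'a\<close>.
  The extension has degree \<open>m\<close> iff \<open>CARD('a) = CARD('q) ^ m\<close>.\<close>

definition field_embedding :: "('q::field \<Rightarrow> 'a::field) \<Rightarrow> bool" where
  "field_embedding \<iota> \<longleftrightarrow>
     \<iota> 1 = 1 \<and> (\<forall>x y. \<iota> (x + y) = \<iota> x + \<iota> y) \<and> (\<forall>x y. \<iota> (x * y) = \<iota> x * \<iota> y)"

definition ext_scale :: "('q::field \<Rightarrow> 'a::field) \<Rightarrow> 'q \<Rightarrow> 'a \<Rightarrow> 'a" where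
  "ext_scale \<iota> c x = \<iota> c * x"

lemma vector_space_ext_scale:
  assumes "field_embedding \<iota>"
  shows "vector_space (ext_scale \<iota>)"
  using assms
  by unfold_locales (simp_all add: field_embedding_def ext_scale_def algebra_simps)

definition is_basis :: "('q::field \<Rightarrow> 'a::field) \<Rightarrow> ('m \<Rightarrow> 'a) \<Rightarrow> bool" where
  "is_basis \<iota> u \<longleftrightarrow> inj u \<and> \<not> module.dependent (ext_scale \<iota>) (range u) \<and>
     module.span (ext_scale \<iota>) (range u) = UNIV"

text \<open>The subfield with \<open>q ^ k\<close> elements of the extension, if \<open>k\<close> divides its degree.\<close>

definition mid_field :: "('q::{field,finite} \<Rightarrow> 'a::field) \<Rightarrow> nat \<Rightarrow> 'a set" where
  "mid_field \<iota> k = {y. y ^ (CARD('q) ^ k) = y}"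

text \<open>The sum lies in the range of \<open>\<iota>\<close> if \<open>y \<in> mid_field \<iota> k\<close>; the inverse of \<open>\<iota>\<close> views it as an
  element of \<open>'q\<close>. For other \<open>y\<close> the value is meaningless.\<close>

definition rel_trace :: "('q::{field,finite} \<Rightarrow> 'a::field) \<Rightarrow> nat \<Rightarrow> 'a \<Rightarrow> 'q" where
  "rel_trace \<iota> k y = inv \<iota> (\<Sum>i=1..k. y ^ (CARD('q) ^ i))"

definition bilinear_form :: "('q::field \<Rightarrow> 'a::field) \<Rightarrow> ('a \<Rightarrow> 'a \<Rightarrow> 'q) \<Rightarrow> bool" where
  "bilinear_form \<iota> S \<longleftrightarrow>
     (\<forall>x. Vector_Spaces.linear (ext_scale \<iota>) (*) (\<lambda>y. S x y)) \<and>
     (\<forall>y. Vector_Spaces.linear (ext_scale \<iota>) (*) (\<lambda>x. S x y))"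

definition symmetric_bilinear_form :: "('q::field \<Rightarrow> 'a::field) \<Rightarrow> ('a \<Rightarrow> 'a \<Rightarrow> 'q) \<Rightarrow> bool" where
  "symmetric_bilinear_form \<iota> S \<longleftrightarrow> bilinear_form \<iota> S \<and> (\<forall>x y. S x y = S y x)"

definition quadratic_form :: "('q::field \<Rightarrow> 'a::field) \<Rightarrow> ('a \<Rightarrow> 'q) \<Rightarrow> bool" where
  "quadratic_form \<iota> Q \<longleftrightarrow>
     (\<forall>c x. Q (ext_scale \<iota> c x) = c ^ 2 * Q x) \<and>
     bilinear_form \<iota> (\<lambda>x y. Q (x + y) - Q x - Q y)"

text \<open>Characters are called \<open>\<psi>\<close>, because \<open>\<chi>\<close> is the library's binder for vectors.\<close>

definition nontrivial_additive_character :: "('q::field \<Rightarrow> complex) \<Rightarrow> bool" where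
  "nontrivial_additive_character \<psi> \<longleftrightarrow>
     \<psi> 0 = 1 \<and> (\<forall>a b. \<psi> (a + b) = \<psi> a * \<psi> b) \<and> (\<exists>a. \<psi> a \<noteq> 1)"

definition represents_quadratic ::
  "('q::field \<Rightarrow> 'a::field) \<Rightarrow> ('m::finite \<Rightarrow> 'a) \<Rightarrow> ('a \<Rightarrow> 'q) \<Rightarrow> 'q^'m^'m \<Rightarrow> bool" where
  "represents_quadratic \<iota> u Q A \<longleftrightarrow>
     (\<forall>x :: 'q^'m. Q (\<Sum>i\<in>UNIV. ext_scale \<iota> (x $ i) (u i)) =
        (\<Sum>i\<in>UNIV. \<Sum>j\<in>UNIV. A $ i $ j * x $ i * x $ j))"

text \<open>If \<open>u\<close> is a basis, a representing matrix of a quadratic form exists and is unique up to adding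
  an alternating matrix, so for symmetric \<open>S\<close> its choice does not affect the trace.\<close>

definition pairing ::
  "('q::field \<Rightarrow> 'a::field) \<Rightarrow> ('q \<Rightarrow> complex) \<Rightarrow> ('m::finite \<Rightarrow> 'a) \<Rightarrow> ('m \<Rightarrow> 'a) \<Rightarrow>
    ('a \<Rightarrow> 'q) \<Rightarrow> ('a \<Rightarrow> 'a \<Rightarrow> 'q) \<Rightarrow> complex" where
  "pairing \<iota> \<psi> u w Q S =
     (let A = (SOME A. represents_quadratic \<iota> u Q A);
          B = (\<chi> i j. S (w i) (w j))
      in \<psi> (trace (A ** B)))"

text \<open>The expansions for degree \<open>m = 2 * n - 1\<close> and for degree \<open>m = 2 * n\<close>.\<close>

definition quad_odd ::
  "('q::{field,finite} \<Rightarrow> 'a::field) \<Rightarrow> nat \<Rightarrow> (nat \<Rightarrow> 'a) \<Rightarrow> 'a \<Rightarrow> 'q" where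
  "quad_odd \<iota> n f x = (\<Sum>i<n. rel_trace \<iota> (2 * n - 1) (f i * x ^ (CARD('q) ^ i + 1)))"

definition bil_odd ::
  "('q::{field,finite} \<Rightarrow> 'a::field) \<Rightarrow> nat \<Rightarrow> (nat \<Rightarrow> 'a) \<Rightarrow> 'a \<Rightarrow> 'a \<Rightarrow> 'q" where
  "bil_odd \<iota> n g x y = rel_trace \<iota> (2 * n - 1) (g 0 * x * y) +
     (\<Sum>i=1..<n. rel_trace \<iota> (2 * n - 1)
        (g i * (x * y ^ (CARD('q) ^ i) + x ^ (CARD('q) ^ i) * y)))"

definition quad_even ::
  "('q::{field,finite} \<Rightarrow> 'a::field) \<Rightarrow> nat \<Rightarrow> (nat \<Rightarrow> 'a) \<Rightarrow> 'a \<Rightarrow> 'q" where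
  "quad_even \<iota> n f x = (\<Sum>i<n. rel_trace \<iota> (2 * n) (f i * x ^ (CARD('q) ^ i + 1))) +
     rel_trace \<iota> n (f n * x ^ (CARD('q) ^ n + 1))"

definition bil_even ::
  "('q::{field,finite} \<Rightarrow> 'a::field) \<Rightarrow> nat \<Rightarrow> (nat \<Rightarrow> 'a) \<Rightarrow> 'a \<Rightarrow> 'a \<Rightarrow> 'q" where
  "bil_even \<iota> n g x y = rel_trace \<iota> (2 * n) (g 0 * x * y) +
     (\<Sum>i=1..<n. rel_trace \<iota> (2 * n)
        (g i * (x * y ^ (CARD('q) ^ i) + x ^ (CARD('q) ^ i) * y))) +
     rel_trace \<iota> (2 * n) (g n * x * y ^ (CARD('q) ^ n))"

text \<open>Coefficient families are functions on \<open>nat\<close> that are \<open>undefined\<close> outside the index range, which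
  makes unique existence of the function the same as unique existence of the family.\<close>

definition coeffs_odd :: "nat \<Rightarrow> (nat \<Rightarrow> 'a) set" where
  "coeffs_odd n = extensional {..<n}"

definition coeffs_even :: "('q::{field,finite} \<Rightarrow> 'a::field) \<Rightarrow> nat \<Rightarrow> (nat \<Rightarrow> 'a) set" where
  "coeffs_even \<iota> n = {f \<in> extensional {..n}. f n \<in> mid_field \<iota> n}"

end

theory Submission
  imports Defs
begin

text \<open>Let \<open>q\<close> be the order of the base field, \<open>m\<close> the degree and \<open>Tr\<close> the trace. Since
  \<open>Tr x * Tr y = (\<Sum>l<m. Tr (x * y ^ q ^ l))\<close>, expanding a form in coordinates with respect to dual
  bases \<open>u\<close>, \<open>w\<close> of the trace form writes every bilinear form as \<open>\<Sum>l<m. Tr (h l * x * y ^ q ^ l)\<close>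
  and every quadratic form as \<open>\<Sum>l<m. Tr (a l * x ^ (q ^ l + 1))\<close>; invariance of \<open>Tr\<close> under Frobenius
  folds the indices \<open>l\<close> and \<open>m - l\<close>. The identity \<open>\<Sum>k. w k ^ q ^ l * u k ^ q ^ i = (if l = i then 1
  else 0)\<close>, which holds because a linearized polynomial of degree below \<open>q ^ m\<close> is determined by its
  values, shows that the \<open>h l\<close> are unique and that the trace of \<open>A ** B\<close> for the bases \<open>u\<close>, \<open>w\<close> is
  \<open>\<Sum>l<m. Tr (a l * h l)\<close>. As this pairing on the folded coefficients is nondegenerate and depends on
  the quadratic form only, the folded coefficients of the latter are unique as well.\<close>

section \<open>Finite fields, sums and alternating matrices\<close>

text \<open>Multiplication by a nonzero \<open>x\<close> permutes the nonzero elements, so the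
  factor \<open>x ^ (CARD('b) - 1)\<close> leaves their product unchanged.\<close>

lemma power_card_eq_self:
  fixes x :: "'b::{field,finite}"
  shows "x ^ CARD('b) = x"
proof (cases "x = 0")
  case False
  have "(\<Prod>y\<in>UNIV - {0}. y) = (\<Prod>y\<in>UNIV - {0}. x * y)"
    by (rule prod.reindex_bij_witness[of _ "\<lambda>y. x * y" "\<lambda>y. y / x"]) (use False in auto)
  also have "\<dots> = x ^ (CARD('b) - 1) * (\<Prod>y\<in>UNIV - {0}. y)"
    by (simp add: prod.distrib card_Diff_singleton)
  finally have "x ^ (CARD('b) - 1) = 1"
    by simp
  then have "x * x ^ (CARD('b) - 1) = x"
    by simp
  then show ?thesis
    by (metis Suc_diff_1 finite_UNIV_card_ge_0 finite_class.finite_UNIV power_Suc)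
qed (simp add: power_0_left)

text \<open>\<open>rel_trace\<close> sums the Frobenius powers from 1 up to the degree, while sums
  that start at 0 are easier to handle.\<close>

lemma sum_shift_periodic:
  fixes F :: "nat \<Rightarrow> 'b::ab_group_add"
  assumes "F n = F 0"
  shows "(\<Sum>i=1..n. F i) = (\<Sum>i<n. F i)"
proof -
  have "F 0 + (\<Sum>i<n. F (Suc i)) = (\<Sum>i<n. F i) + F n"
    using sum.lessThan_Suc_shift[of F n] sum.lessThan_Suc[of F n] by simp
  then show ?thesis
    using assms by (simp add: sum.atLeast1_atMost_eq)
qed

lemma linear_ext_scale_iff:
  assumes "field_embedding \<iota>"
  shows "Vector_Spaces.linear (ext_scale \<iota>) (*) f \<longleftrightarrow>
    (\<forall>x y. f (x + y) = f x + f y) \<and> (\<forall>c x. f (\<iota> c * x) = c * f x)"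
proof -
  have "vector_space ((*) :: 'a \<Rightarrow> _)"
    by unfold_locales (simp_all add: algebra_simps)
  with vector_space_ext_scale[OF assms] show ?thesis
    by (auto simp: Vector_Spaces.linear_iff ext_scale_def)
qed

text \<open>Swapping the indices would only show that twice the sum is 0, which is void in
  characteristic 2. The induction cancels the entries at \<open>(k, j)\<close> and
  \<open>(j, k)\<close> directly.\<close>

lemma alternating_symmetric_sum_eq_0:
  fixes D B :: "'m \<Rightarrow> 'm \<Rightarrow> 'b::comm_ring"
  assumes "finite F"
    and "\<And>i. D i i = 0" and anti: "\<And>i j. D i j + D j i = 0" and sym: "\<And>i j. B i j = B j i"
  shows "(\<Sum>i\<in>F. \<Sum>j\<in>F. D i j * B i j) = 0"
  using \<open>finite F\<close>
proof induction
  case (insert k F)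
  have "(\<Sum>i\<in>insert k F. \<Sum>j\<in>insert k F. D i j * B i j) =
      (\<Sum>j\<in>F. D k j * B k j) + (\<Sum>i\<in>F. D i k * B i k)"
    using insert assms(2) by (simp add: sum.distrib)
  also have "\<dots> = (\<Sum>j\<in>F. (D k j + D j k) * B k j)"
    by (simp add: distrib_right sum.distrib sym[of _ k])
  finally show ?case
    by (simp add: anti)
qed simp

text \<open>Indicator vectors of sets with one or two elements suffice as test vectors, and these
  are available over every ring.\<close>

lemma quadratic_zero_alternating:
  fixes D :: "'m::finite \<Rightarrow> 'm \<Rightarrow> 'b::comm_ring_1"
  assumes zero: "\<And>x. (\<Sum>i\<in>UNIV. \<Sum>j\<in>UNIV. D i j * x i * x j) = 0"
  shows "D i i = 0" and "D i j + D j i = 0"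
proof -
  have restricted: "(\<Sum>s\<in>F. \<Sum>t\<in>F. D s t) = 0" for F
  proof -
    have "(\<Sum>s\<in>F. \<Sum>t\<in>F. D s t) =
        (\<Sum>s\<in>UNIV. \<Sum>t\<in>UNIV. D s t * of_bool (s \<in> F) * of_bool (t \<in> F))"
      by (intro sum.mono_neutral_cong_left) auto
    with zero[of "\<lambda>s. of_bool (s \<in> F)"] show ?thesis by simp
  qed
  show diag: "D i i = 0" for i
    using restricted[of "{i}"] by simp
  show "D i j + D j i = 0"
    using restricted[of "{i, j}"] by (cases "i = j") (simp_all add: diag)
qed

text \<open>Two representing matrices differ by an alternating matrix, whose product with a
  symmetric one has trace 0. Hence the choice by \<open>SOME\<close> in \<open>pairing\<close> is
  harmless.\<close>

lemma trace_unique_of_represents: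
  fixes A A' B :: "'b::field^'m^'m::finite"
  assumes "represents_quadratic \<iota> u Q A" "represents_quadratic \<iota> u Q A'"
    and sym: "\<And>i j. B $ i $ j = B $ j $ i"
  shows "trace (A ** B) = trace (A' ** B)"
proof -
  let ?D = "\<lambda>i j. A $ i $ j - A' $ i $ j"
  have "(\<Sum>i\<in>UNIV. \<Sum>j\<in>UNIV. ?D i j * x i * x j) = 0" for x
  proof -
    have "(\<Sum>i\<in>UNIV. \<Sum>j\<in>UNIV. A $ i $ j * x i * x j) =
        (\<Sum>i\<in>UNIV. \<Sum>j\<in>UNIV. A' $ i $ j * x i * x j)"
      using assms(1,2)[unfolded represents_quadratic_def, rule_format, of "\<chi> i. x i"] by simp
    then show ?thesis
      by (simp add: left_diff_distrib sum_subtractf)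
  qed
  note D = quadratic_zero_alternating[of ?D, OF this]
  have "trace (A ** B) - trace (A' ** B) = (\<Sum>i\<in>UNIV. \<Sum>j\<in>UNIV. ?D i j * B $ j $ i)"
    by (simp add: trace_def matrix_matrix_mult_def left_diff_distrib sum_subtractf)
  also have "\<dots> = 0"
    by (intro alternating_symmetric_sum_eq_0 D sym) simp
  finally show ?thesis by simp
qed

text \<open>Reflecting \<open>l\<close> to \<open>m - l\<close> pairs the indices, except 0, whose
  partner \<open>m\<close> is out of range, and \<open>m div 2\<close> for even \<open>m\<close>,
  which is its own partner.\<close>

lemma sum_fold_half:
  fixes F :: "nat \<Rightarrow> 'b::comm_monoid_add"
  assumes "0 < m"
  shows "(\<Sum>l<m. F l) = F 0 + (\<Sum>l | 0 < l \<and> 2 * l < m. F l + F (m - l)) +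
    (if even m then F (m div 2) else 0)"
proof -
  let ?J = "{l. 0 < l \<and> 2 * l < m}"
  let ?N = "(\<lambda>l. m - l) ` ?J"
  let ?M = "if even m then {m div 2} else {}"
  have [simp]: "finite ?J"
    by (rule finite_subset[of _ "{..m}"]) auto
  have "{..<m} = {0} \<union> (?J \<union> (?N \<union> ?M))"
  proof (intro equalityI subsetI)
    fix l assume l: "l \<in> {..<m}"
    then have "l \<in> ?N" if "m < 2 * l"
      using that by (intro image_eqI[where x = "m - l"]) auto
    then show "l \<in> {0} \<union> (?J \<union> (?N \<union> ?M))"
      using l by (cases "2 * l" m rule: linorder_cases) auto
  qed (use assms in \<open>auto split: if_splits\<close>)
  moreover have "sum F (?N) = (\<Sum>l\<in>?J. F (m - l))"
    by (rule sum.reindex_cong[where l = "\<lambda>l. m - l"]) (auto simp: inj_on_def)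
  moreover have "sum F ({0} \<union> (?J \<union> (?N \<union> ?M))) = F 0 + (sum F ?J + (sum F ?N + sum F ?M))"
  proof -
    have disjoint: "{0} \<inter> (?J \<union> (?N \<union> ?M)) = {}" "?J \<inter> (?N \<union> ?M) = {}" "?N \<inter> ?M = {}"
      using assms by (auto split: if_splits)
    show ?thesis
      by (subst sum.union_disjoint[OF _ _ disjoint(1)], simp, simp,
          subst sum.union_disjoint[OF _ _ disjoint(2)], simp, simp,
          subst sum.union_disjoint[OF _ _ disjoint(3)]) simp_all
  qed
  ultimately show ?thesis
    by (simp add: sum.distrib add.assoc)
qed

lemma sum_half:
  fixes F :: "nat \<Rightarrow> 'b::comm_monoid_add"
  assumes "0 < m"
  shows "(\<Sum>l | 2 * l < m. F l) = F 0 + (\<Sum>l | 0 < l \<and> 2 * l < m. F l)"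
proof -
  have "{l. 2 * l < m} = insert 0 {l. 0 < l \<and> 2 * l < m}"
    using assms by auto
  moreover have "finite {l. 0 < l \<and> 2 * l < m}"
    by (rule finite_subset[of _ "{..m}"]) auto
  ultimately show ?thesis by simp
qed

section \<open>Frobenius powers and the trace\<close>

locale finite_field_extension =
  fixes \<iota> :: "'q::{field,finite} \<Rightarrow> 'a::{field,finite}" and m :: nat
  assumes embedding: "field_embedding \<iota>"
    and card_extension: "CARD('a) = CARD('q) ^ m"
    and degree_pos: "0 < m"
begin

definition frob :: "nat \<Rightarrow> 'a \<Rightarrow> 'a" where
  "frob i x = x ^ (CARD('q) ^ i)"

abbreviation tr :: "'a \<Rightarrow> 'q" where
  "tr \<equiv> rel_trace \<iota> m"

lemma iota_1 [simp]: "\<iota> 1 = 1"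
  and iota_add: "\<iota> (a + b) = \<iota> a + \<iota> b"
  and iota_mult: "\<iota> (a * b) = \<iota> a * \<iota> b"
  using embedding by (auto simp: field_embedding_def)

lemma iota_0 [simp]: "\<iota> 0 = 0"
  using iota_add[of 0 0] by (metis add_0_right add_left_cancel)

lemma iota_uminus: "\<iota> (- a) = - \<iota> a"
  using iota_add[of a "- a"] by (simp add: eq_neg_iff_add_eq_0 add.commute)

lemma iota_diff: "\<iota> (a - b) = \<iota> a - \<iota> b"
  using iota_add[of a "- b"] by (simp add: iota_uminus)

lemma iota_eq_0_iff [simp]: "\<iota> a = 0 \<longleftrightarrow> a = 0"
proof
  assume a: "\<iota> a = 0"
  show "a = 0"
  proof (rule ccontr)
    assume "a \<noteq> 0"
    then have "\<iota> a * \<iota> (inverse a) = 1"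
      by (simp flip: iota_mult)
    with a show False by simp
  qed
qed simp

lemma inj_iota: "inj \<iota>"
  by (rule injI) (metis iota_diff iota_eq_0_iff right_minus_eq)

lemma iota_eq_iff: "\<iota> a = \<iota> b \<longleftrightarrow> a = b"
  using inj_iota by (auto dest: injD)

lemma iota_sum: "\<iota> (sum f A) = (\<Sum>i\<in>A. \<iota> (f i))"
  by (induction A rule: infinite_finite_induct) (simp_all add: iota_add)

lemma iota_power: "\<iota> (a ^ n) = \<iota> a ^ n"
  by (induction n) (simp_all add: iota_mult)

lemma card_base_gt_1: "1 < CARD('q)"
proof -
  have "card {0, 1 :: 'q} \<le> CARD('q)"
    by (rule card_mono) auto
  then show ?thesis by simp
qed

lemma card_range_iota: "card (range \<iota>) = CARD('q)"
  using inj_iota by (rule card_image)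

text \<open>Two monic polynomials of degree \<open>q\<close> that agree on the \<open>q\<close> elements of the subfield are equal;
  hence \<open>(c + X) ^ q = c ^ q + X ^ q\<close> first for \<open>c\<close> in the subfield, then for all \<open>c\<close>.\<close>
lemma power_card_add_aux:
  fixes a x :: 'a
  assumes "\<And>b. (a + \<iota> b) ^ CARD('q) = a ^ CARD('q) + \<iota> b ^ CARD('q)"
  shows "(a + x) ^ CARD('q) = a ^ CARD('q) + x ^ CARD('q)"
proof -
  let ?q = "CARD('q)"
  have "[:a, 1:] ^ ?q = monom 1 ?q + [:a ^ ?q:]"
  proof (rule poly_eqI_degree_lead_coeff[where n = ?q and A = "range \<iota>"])
    show "poly.coeff ([:a, 1:] ^ ?q) ?q = poly.coeff (monom 1 ?q + [:a ^ ?q:]) ?q"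
      by (simp add: coeff_linear_power coeff_pCons split: nat.split)
    show "degree ([:a, 1:] ^ ?q) \<le> ?q"
      by (simp add: degree_linear_power)
    show "degree (monom 1 ?q + [:a ^ ?q:]) \<le> ?q"
      by (intro degree_add_le degree_monom_le) simp
    show "poly ([:a, 1:] ^ ?q) z = poly (monom 1 ?q + [:a ^ ?q:]) z" if "z \<in> range \<iota>" for z
      using that assms by (auto simp: poly_monom add.commute)
  qed (simp add: card_range_iota)
  then have "poly ([:a, 1:] ^ ?q) x = poly (monom 1 ?q + [:a ^ ?q:]) x"
    by simp
  then show ?thesis
    by (simp add: poly_monom add.commute)
qed

lemma power_card_add:
  fixes x y :: 'a
  shows "(x + y) ^ CARD('q) = x ^ CARD('q) + y ^ CARD('q)"
proof (rule power_card_add_aux)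
  fix b
  have "(\<iota> b + x) ^ CARD('q) = \<iota> b ^ CARD('q) + x ^ CARD('q)"
    by (rule power_card_add_aux)
      (simp add: power_card_eq_self flip: iota_add iota_power)
  then show "(x + \<iota> b) ^ CARD('q) = x ^ CARD('q) + \<iota> b ^ CARD('q)"
    by (simp add: add.commute)
qed

lemma frob_0 [simp]: "frob 0 x = x"
  by (simp add: frob_def)

lemma frob_frob: "frob i (frob j x) = frob (i + j) x"
  by (simp add: frob_def power_add mult.commute flip: power_mult)

lemma frob_Suc: "frob (Suc i) x = frob i x ^ CARD('q)"
  by (simp add: frob_def mult.commute flip: power_mult)

lemma frob_add: "frob i (x + y) = frob i x + frob i y"
  by (induction i) (simp_all add: frob_Suc power_card_add)

lemma frob_mult: "frob i (x * y) = frob i x * frob i y"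
  by (simp add: frob_def power_mult_distrib)

lemma frob_inverse: "frob i (inverse x) = inverse (frob i x)"
  by (simp add: frob_def power_inverse)

lemma frob_of_0 [simp]: "frob i 0 = 0"
  by (simp add: frob_def power_0_left)

lemma frob_sum: "frob i (sum f A) = (\<Sum>j\<in>A. frob i (f j))"
  by (induction A rule: infinite_finite_induct) (simp_all add: frob_add)

lemma frob_iota [simp]: "frob i (\<iota> a) = \<iota> a"
  by (induction i) (simp_all add: frob_Suc power_card_eq_self flip: iota_power)

lemma frob_degree [simp]: "frob m x = x"
  using power_card_eq_self[of x] by (simp add: frob_def card_extension)

text \<open>The image consists of \<open>CARD('q)\<close> fixed points of the Frobenius map, and the
  polynomial \<open>?p\<close> has no more roots than that.\<close>

lemma range_iota: "range \<iota> = {x. frob 1 x = x}"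
proof (rule card_seteq)
  let ?p = "monom 1 CARD('q) - [:0, 1:] :: 'a poly"
  have "poly.coeff ?p CARD('q) = 1"
    using card_base_gt_1 by (simp add: coeff_pCons split: nat.split)
  then have "?p \<noteq> 0"
    by force
  then have "card {x. poly ?p x = 0} \<le> degree ?p"
    by (rule card_poly_roots_bound)
  also have "\<dots> \<le> CARD('q)"
    using card_base_gt_1 by (intro degree_diff_le degree_monom_le) simp
  finally show "card {x. frob 1 x = x} \<le> card (range \<iota>)"
    by (simp add: card_range_iota poly_monom frob_def)
qed auto

text \<open>The Frobenius map shifts the sum cyclically and so fixes it; hence it lies in the range
  of \<iota>, where \<open>inv \<iota>\<close> is a true inverse. A general \<open>n\<close> serves
  both the whole field and its middle subfield.\<close>

lemma iota_rel_trace: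
  assumes "frob n z = z"
  shows "\<iota> (rel_trace \<iota> n z) = (\<Sum>i<n. frob i z)"
proof -
  have eq: "(\<Sum>i=1..n. frob i z) = (\<Sum>i<n. frob i z)"
    using assms by (intro sum_shift_periodic) simp
  have "frob 1 (\<Sum>i<n. frob i z) = (\<Sum>i=1..n. frob i z)"
    by (simp add: frob_sum frob_frob sum.atLeast1_atMost_eq)
  then have "(\<Sum>i<n. frob i z) \<in> range \<iota>"
    by (simp only: range_iota eq mem_Collect_eq)
  then show ?thesis
    using eq by (simp add: rel_trace_def f_inv_into_f flip: frob_def)
qed

lemma iota_tr: "\<iota> (tr x) = (\<Sum>i<m. frob i x)"
  by (rule iota_rel_trace) simp

lemma tr_add: "tr (x + y) = tr x + tr y"
  by (simp add: iota_tr iota_add frob_add sum.distrib flip: iota_eq_iff)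

lemma tr_0 [simp]: "tr 0 = 0"
  by (simp add: iota_tr flip: iota_eq_iff)

lemma tr_diff: "tr (x - y) = tr x - tr y"
  using tr_add[of "x - y" y] by simp

lemma tr_sum: "tr (sum f A) = (\<Sum>i\<in>A. tr (f i))"
  by (induction A rule: infinite_finite_induct) (simp_all add: tr_add)

lemma tr_scale: "tr (\<iota> c * x) = c * tr x"
  by (simp add: iota_tr iota_mult frob_mult sum_distrib_left flip: iota_eq_iff)

text \<open>Each Frobenius step merely rotates the summands of the trace.\<close>

lemma tr_frob: "tr (frob i x) = tr x"
proof -
  have "(\<Sum>j<m. frob j (frob 1 y)) = (\<Sum>j<m. frob j y)" for y
    using sum_shift_periodic[of "\<lambda>j. frob j y" m]
    by (simp add: frob_frob sum.atLeast1_atMost_eq)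
  then have step: "tr (frob 1 y) = tr y" for y
    by (simp only: iota_tr flip: iota_eq_iff)
  show ?thesis
  proof (induction i)
    case (Suc i)
    then show ?case
      using step[of "frob i x"] by (simp add: frob_frob)
  qed simp
qed

text \<open>The factor \<open>tr y\<close> is a scalar, so it can be moved inside
  \<open>tr x\<close> and expanded there into Frobenius powers.\<close>

lemma tr_mult_tr: "tr x * tr y = (\<Sum>l<m. tr (x * frob l y))"
proof -
  have "tr x * tr y = tr (x * \<iota> (tr y))"
    using tr_scale[of "tr y" x] by (simp add: mult.commute)
  then show ?thesis
    by (simp add: iota_tr sum_distrib_left tr_sum)
qed

section \<open>Linearized polynomials and nondegeneracy\<close>

text \<open>A polynomial of degree below \<open>CARD('a)\<close> that vanishes everywhere is 0, and
  each \<open>c s\<close> is one of its coefficients because the exponents are distinct.\<close>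

lemma linearized_polynomial_coeffs:
  assumes "\<And>x. (\<Sum>s<m. c s * frob s x) = 0" and "s < m"
  shows "c s = 0"
proof -
  let ?p = "\<Sum>s<m. monom (c s) (CARD('q) ^ s)"
  have "degree ?p \<le> CARD('q) ^ (m - 1)"
    using card_base_gt_1
    by (intro degree_sum_le) (auto intro!: order.trans[OF degree_monom_le] power_increasing)
  also have "\<dots> < CARD('a)"
    using card_base_gt_1 degree_pos by (simp add: card_extension)
  finally have "?p = 0"
    using assms(1)
    by (intro poly_eqI_degree[where A = UNIV]) (simp_all add: poly_sum poly_monom frob_def)
  then have "poly.coeff ?p (CARD('q) ^ s) = 0"
    by simp
  moreover have "poly.coeff ?p (CARD('q) ^ s) = (\<Sum>t<m. if t = s then c t else 0)"
    using card_base_gt_1 by (auto simp: coeff_sum coeff_monom intro!: sum.cong)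
  ultimately show ?thesis
    using assms(2) by (simp add: sum.delta)
qed

text \<open>As a function of \<open>x\<close>, the trace of \<open>c * x\<close> is a linearized
  polynomial whose lowest coefficient is \<open>c\<close>.\<close>

lemma tr_nondegenerate:
  assumes "\<And>x. tr (c * x) = 0"
  shows "c = 0"
proof -
  have "frob 0 c = 0"
  proof (rule linearized_polynomial_coeffs[where c = "\<lambda>s. frob s c"])
    show "(\<Sum>s<m. frob s c * frob s x) = 0" for x
      using assms[of x] iota_tr[of "c * x"] by (simp add: frob_mult)
  qed (rule degree_pos)
  then show ?thesis by simp
qed

section \<open>Bilinear forms and twisted trace forms\<close>

lemma bilinear_form_iff:
  "bilinear_form \<iota> S \<longleftrightarrow>
    (\<forall>x y z. S x (y + z) = S x y + S x z) \<and> (\<forall>c x y. S x (\<iota> c * y) = c * S x y) \<and>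
    (\<forall>x y z. S (x + y) z = S x z + S y z) \<and> (\<forall>c x y. S (\<iota> c * x) y = c * S x y)"
  unfolding bilinear_form_def linear_ext_scale_iff[OF embedding] by blast

lemma bilinear_form_sum:
  assumes "bilinear_form \<iota> S"
  shows "S (\<Sum>j\<in>A. \<iota> (c j) * v j) (\<Sum>k\<in>B. \<iota> (d k) * v' k) =
    (\<Sum>j\<in>A. \<Sum>k\<in>B. S (v j) (v' k) * c j * d k)"
proof -
  from assms have add: "S (x + y) z = S x z + S y z" "S x (y + z) = S x y + S x z"
    and scale: "S (\<iota> e * x) y = e * S x y" "S x (\<iota> e * y) = e * S x y" for x y z e
    by (simp_all add: bilinear_form_iff)
  have zero: "S 0 z = 0" "S x 0 = 0" for x z
    using scale(1)[where e = 0] scale(2)[where e = 0] by (simp_all del: mult_eq_0_iff)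
  have left: "S (sum f A) z = (\<Sum>j\<in>A. S (f j) z)" for f z
    by (induction A rule: infinite_finite_induct) (simp_all add: add zero)
  have right: "S x (sum f B) = (\<Sum>k\<in>B. S x (f k))" for f x
    by (induction B rule: infinite_finite_induct) (simp_all add: add zero)
  show ?thesis
    by (simp only: left) (simp only: right scale, simp add: mult_ac)
qed

text \<open>The common normal form: all bilinear forms have this shape, and quadratic forms are its
  restrictions to the diagonal.\<close>

definition twisted_form :: "(nat \<Rightarrow> 'a) \<Rightarrow> 'a \<Rightarrow> 'a \<Rightarrow> 'q" where
  "twisted_form h x y = (\<Sum>l<m. tr (h l * x * frob l y))"

lemma bilinear_twisted_form: "bilinear_form \<iota> (twisted_form h)"
proof -
  have "tr (h l * (\<iota> c * x) * z) = c * tr (h l * x * z)" "tr (h l * x * (\<iota> c * z)) = c * tr (h l * x * z)"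
    for l c x z
    using tr_scale[of c "h l * x * z"] by (simp_all add: mult_ac)
  then show ?thesis
    by (simp add: bilinear_form_iff twisted_form_def frob_add frob_mult distrib_left distrib_right
        tr_add sum.distrib sum_distrib_left)
qed

section \<open>Dual bases of the trace form\<close>

text \<open>Stating both expansions makes the coordinates traces and keeps the notion symmetric in
  \<open>u\<close> and \<open>w\<close>; that the families are bases is derived from it.\<close>

definition dual_bases :: "('m::finite \<Rightarrow> 'a) \<Rightarrow> ('m \<Rightarrow> 'a) \<Rightarrow> bool" where
  "dual_bases u w \<longleftrightarrow>
    (\<forall>x. (\<Sum>k\<in>UNIV. \<iota> (tr (x * w k)) * u k) = x) \<and>
    (\<forall>x. (\<Sum>k\<in>UNIV. \<iota> (tr (x * u k)) * w k) = x) \<and>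
    (\<forall>j k. tr (u j * w k) = (if j = k then 1 else 0))"

lemma dual_bases_commute: "dual_bases u w \<Longrightarrow> dual_bases w u"
  by (auto simp: dual_bases_def mult.commute)

text \<open>The expansion gives spanning, and the functional given by \<open>w j\<close> separates
  \<open>u j\<close> from the span of the other elements.\<close>

lemma is_basis_dual_bases:
  assumes dual: "dual_bases u w"
  shows "is_basis \<iota> u"
proof -
  interpret V: vector_space "ext_scale \<iota>"
    using embedding by (rule vector_space_ext_scale)
  have delta: "tr (u j * w k) = (if j = k then 1 else 0)" for j k
    using dual by (simp add: dual_bases_def)
  have "inj u"
    by (rule injI) (metis delta zero_neq_one)
  moreover have "x \<in> V.span (range u)" for x
  proof -
    have "(\<Sum>k\<in>UNIV. ext_scale \<iota> (tr (x * w k)) (u k)) \<in> V.span (range u)"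
      by (intro V.span_sum V.span_scale V.span_base rangeI)
    with dual show ?thesis
      by (simp add: dual_bases_def ext_scale_def)
  qed
  moreover have "\<not> V.dependent (range u)"
  proof
    assume "V.dependent (range u)"
    then obtain j where "u j \<in> V.span (range u - {u j})"
      by (auto simp: V.dependent_def)
    moreover have "V.span (range u - {u j}) \<subseteq> {x. tr (x * w j) = 0}"
      by (rule V.span_minimal)
        (auto simp: delta V.subspace_def ext_scale_def distrib_right mult.assoc tr_add tr_scale)
    ultimately show False
      using delta[of j j] by auto
  qed
  ultimately show ?thesis
    by (auto simp: is_basis_def)
qed

text \<open>Counting combinations of a basis \<open>B\<close> gives
  \<open>CARD('q) ^ card B = CARD('a)\<close>, so \<open>B\<close> has \<open>m\<close> elements and
  can be indexed by \<open>'m\<close>.\<close>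

lemma spanning_family_exists:
  assumes "CARD('m) = m"
  obtains u :: "'m::finite \<Rightarrow> 'a" where "\<And>x. \<exists>c. x = (\<Sum>k\<in>UNIV. \<iota> (c k) * u k)"
proof -
  interpret V: vector_space "ext_scale \<iota>"
    using embedding by (rule vector_space_ext_scale)
  obtain B where B: "V.independent B" "UNIV \<subseteq> V.span B"
    by (rule V.maximal_independent_subset[of UNIV]) (rule that)
  let ?comb = "\<lambda>c. \<Sum>b\<in>B. ext_scale \<iota> (c b) b"
  \<comment> \<open>Coefficient functions in \<open>B \<rightarrow>\<^sub>E UNIV\<close> are fixed
    outside \<open>B\<close>, so each combination is counted once.\<close>
  have "inj_on ?comb (B \<rightarrow>\<^sub>E UNIV)"
  proof (rule inj_onI)
    fix c d assume c: "c \<in> B \<rightarrow>\<^sub>E UNIV" and d: "d \<in> B \<rightarrow>\<^sub>E UNIV" and eq: "?comb c = ?comb d"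
    have "(\<Sum>b\<in>B. ext_scale \<iota> (c b - d b) b) = 0"
      using eq by (simp add: V.scale_left_diff_distrib sum_subtractf)
    then have "c b - d b = 0" if "b \<in> B" for b
      using V.independentD[OF B(1), of B "\<lambda>b. c b - d b" b] that by simp
    with c d show "c = d"
      by (intro PiE_ext[of c B "\<lambda>_. UNIV" d]) simp_all
  qed
  moreover have image: "?comb ` (B \<rightarrow>\<^sub>E UNIV) = UNIV"
  proof -
    have "\<exists>c\<in>B \<rightarrow>\<^sub>E UNIV. x = ?comb c" for x
    proof -
      from B(2) obtain d where "x = ?comb d"
        using V.span_finite[of B] by auto
      then have "x = ?comb (restrict d B)"
        by simp
      then show ?thesis
        by (rule bexI[where x = "restrict d B"]) simp
    qed
    then show ?thesis by blast
  qed
  ultimately have "card (?comb ` (B \<rightarrow>\<^sub>E UNIV)) = card (B \<rightarrow>\<^sub>E (UNIV :: 'q set))"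
    by (intro card_image)
  then have "CARD('a) = card (B \<rightarrow>\<^sub>E (UNIV :: 'q set))"
    by (simp only: image)
  then have "card B = CARD('m)"
    using card_base_gt_1 by (simp add: card_PiE card_extension assms)
  then obtain u :: "'m \<Rightarrow> 'a" where u: "bij_betw u UNIV B"
    using finite_same_card_bij[of "UNIV :: 'm set" B] by auto
  have "\<exists>c. x = (\<Sum>k\<in>UNIV. \<iota> (c k) * u k)" for x
  proof -
    obtain d where "x = ?comb d"
      using image by blast
    then have "x = (\<Sum>k\<in>UNIV. \<iota> (d (u k)) * u k)"
      by (simp add: ext_scale_def flip: sum.reindex_bij_betw[OF u])
    then show ?thesis by (rule exI[of _ "d \<circ> u", unfolded comp_def])
  qed
  then show thesis by (rule that)
qed

text \<open>Nondegeneracy makes \<open>w \<mapsto> (tr (w * u k))\<^sub>k\<close> injective, hence bijective by counting; the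
  preimages of the unit vectors form the dual basis.\<close>
lemma dual_bases_exist:
  assumes "CARD('m) = m"
  obtains u w :: "'m::finite \<Rightarrow> 'a" where "dual_bases u w"
proof -
  obtain u :: "'m \<Rightarrow> 'a" where u: "\<And>x. \<exists>c. x = (\<Sum>k\<in>UNIV. \<iota> (c k) * u k)"
    using spanning_family_exists[OF assms] by metis
  let ?\<Phi> = "\<lambda>w k. tr (w * u k)"
  have inj: "inj ?\<Phi>"
  proof (rule injI)
    fix v w assume "?\<Phi> v = ?\<Phi> w"
    then have eq: "tr ((v - w) * u k) = 0" for k
      by (simp add: fun_eq_iff left_diff_distrib tr_diff)
    have "tr ((v - w) * x) = 0" for x
    proof -
      obtain c where "x = (\<Sum>k\<in>UNIV. \<iota> (c k) * u k)"
        using u by blast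
      then have "tr ((v - w) * x) = (\<Sum>k\<in>UNIV. tr (\<iota> (c k) * ((v - w) * u k)))"
        by (simp add: sum_distrib_left mult.left_commute flip: tr_sum)
      then show ?thesis
        by (simp add: tr_scale eq)
    qed
    then show "v = w"
      using tr_nondegenerate by force
  qed
  have surj: "range ?\<Phi> = UNIV"
    by (rule card_subset_eq)
      (simp_all add: card_image[OF inj] card_extension card_fun assms degree_pos)
  define w where "w k = inv ?\<Phi> (\<lambda>j. if j = k then 1 else 0)" for k
  have w: "?\<Phi> (w k) = (\<lambda>j. if j = k then 1 else 0)" for k
    unfolding w_def by (rule surj_f_inv_f[OF surj])
  have delta: "tr (u j * w k) = (if j = k then 1 else 0)" for j k
    using fun_cong[OF w[of k], of j] by (simp add: mult.commute)
  have "(\<Sum>k\<in>UNIV. \<iota> (tr (x * w k)) * u k) = x" for x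
  proof -
    obtain c where c: "x = (\<Sum>k\<in>UNIV. \<iota> (c k) * u k)"
      using u by blast
    have "tr (x * w k) = c k" for k
    proof -
      have "tr (x * w k) = (\<Sum>j\<in>UNIV. tr (\<iota> (c j) * (u j * w k)))"
        by (simp add: c sum_distrib_right mult.assoc tr_sum)
      then show ?thesis
        by (simp add: tr_scale delta if_distrib cong: if_cong)
    qed
    then show ?thesis using c by simp
  qed
  \<comment> \<open>As \<open>?\<Phi>\<close> is injective, it suffices that both sides have the
    same trace against every \<open>u j\<close>.\<close>
  moreover have "(\<Sum>k\<in>UNIV. \<iota> (tr (x * u k)) * w k) = x" for x
  proof (rule injD[OF inj], rule ext)
    fix j
    have "tr ((\<Sum>k\<in>UNIV. \<iota> (tr (x * u k)) * w k) * u j) =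
        (\<Sum>k\<in>UNIV. tr (\<iota> (tr (x * u k)) * (u j * w k)))"
      unfolding sum_distrib_right tr_sum by (simp add: mult_ac)
    then show "tr ((\<Sum>k\<in>UNIV. \<iota> (tr (x * u k)) * w k) * u j) = tr (x * u j)"
      by (simp add: tr_scale delta if_distrib cong: if_cong)
  qed
  ultimately have "dual_bases u w"
    using delta by (simp add: dual_bases_def)
  then show thesis by (rule that)
qed

text \<open>With the traces written out, the expansion of \<open>x\<close> in the basis
  \<open>u\<close> is a linearized polynomial in \<open>x\<close> that agrees with the identity, so
  their coefficients agree.\<close>

lemma dual_bases_frob_aux:
  assumes dual: "dual_bases u w" and "s < m"
  shows "(\<Sum>k\<in>UNIV. frob s (w k) * u k) = (if s = 0 then 1 else 0)"
proof -
  let ?c = "\<lambda>s. (\<Sum>k\<in>UNIV. frob s (w k) * u k)"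
  have "?c s - (if s = 0 then 1 else 0) = 0"
  proof (rule linearized_polynomial_coeffs[where c = "\<lambda>s. ?c s - (if s = 0 then 1 else 0)"])
    fix x
    have "(\<Sum>s<m. ?c s * frob s x) = (\<Sum>k\<in>UNIV. \<iota> (tr (x * w k)) * u k)"
      unfolding iota_tr frob_mult sum_distrib_right
      by (subst sum.swap) (simp add: mult_ac)
    also have "\<dots> = x"
      using dual by (simp add: dual_bases_def)
    finally show "(\<Sum>s<m. (?c s - (if s = 0 then 1 else 0)) * frob s x) = 0"
      using degree_pos
      by (simp add: left_diff_distrib sum_subtractf if_distrib[of "\<lambda>z. z * _"] cong: if_cong)
  qed fact
  then show ?thesis by simp
qed

text \<open>Taking out the smaller Frobenius power leaves the case of one twisted factor, for the
  given bases or for the exchanged ones.\<close>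

lemma dual_bases_frob:
  assumes dual: "dual_bases u w" and "l < m" "i < m"
  shows "(\<Sum>k\<in>UNIV. frob l (w k) * frob i (u k)) = (if l = i then 1 else 0)"
proof (cases "i \<le> l")
  case True
  then have "(\<Sum>k\<in>UNIV. frob l (w k) * frob i (u k)) =
      frob i (\<Sum>k\<in>UNIV. frob (l - i) (w k) * u k)"
    by (simp add: frob_sum frob_mult frob_frob)
  also have "\<dots> = (if l = i then 1 else 0)"
    using dual_bases_frob_aux[OF dual, of "l - i"] True assms(2) frob_iota[of i 1] by auto
  finally show ?thesis .
next
  case False
  then have "(\<Sum>k\<in>UNIV. frob l (w k) * frob i (u k)) =
      frob l (\<Sum>k\<in>UNIV. frob (i - l) (u k) * w k)"
    by (simp add: frob_sum frob_mult frob_frob mult.commute)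
  also have "\<dots> = 0"
    using dual_bases_frob_aux[OF dual_bases_commute[OF dual], of "i - l"] False assms(3) by simp
  finally show ?thesis
    using False by simp
qed

section \<open>Coefficients of bilinear forms\<close>

text \<open>The coefficient of \<open>x * frob l y\<close> that results when both arguments are
  written in the basis \<open>w\<close> and the products of traces are expanded.\<close>

definition form_coeff :: "('m::finite \<Rightarrow> 'a) \<Rightarrow> ('m \<Rightarrow> 'a) \<Rightarrow> ('a \<Rightarrow> 'a \<Rightarrow> 'q) \<Rightarrow> nat \<Rightarrow> 'a" where
  "form_coeff u w S l = (\<Sum>j\<in>UNIV. \<Sum>k\<in>UNIV. \<iota> (S (w j) (w k)) * u j * frob l (u k))"

text \<open>The matrix \<open>B\<close> is arbitrary, because it will be either the Gram matrix of a
  bilinear form or a representing matrix of a quadratic form.\<close>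

lemma tr_products_twisted_form:
  "(\<Sum>j\<in>UNIV. \<Sum>k\<in>UNIV. B j k * tr (x * u j) * tr (y * u k)) =
    twisted_form (\<lambda>l. \<Sum>j\<in>UNIV. \<Sum>k\<in>UNIV. \<iota> (B j k) * u j * frob l (u k)) x y"
proof -
  have "B j k * tr (x * u j) * tr (y * u k) =
      (\<Sum>l<m. tr (\<iota> (B j k) * u j * frob l (u k) * x * frob l y))" for j k
  proof -
    have "B j k * tr (x * u j) * tr (y * u k) = (\<Sum>l<m. B j k * tr (x * u j * frob l (y * u k)))"
      by (simp add: mult.assoc tr_mult_tr sum_distrib_left)
    also have "\<dots> = (\<Sum>l<m. tr (\<iota> (B j k) * (x * u j * frob l (y * u k))))"
      by (simp only: tr_scale)
    finally show ?thesis
      by (simp add: frob_mult mult_ac)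
  qed
  then have "(\<Sum>j\<in>UNIV. \<Sum>k\<in>UNIV. B j k * tr (x * u j) * tr (y * u k)) =
      (\<Sum>j\<in>UNIV. \<Sum>l<m. \<Sum>k\<in>UNIV. tr (\<iota> (B j k) * u j * frob l (u k) * x * frob l y))"
    by (simp add: sum.swap[of _ "{..<m}"])
  also have "\<dots> = (\<Sum>l<m. \<Sum>j\<in>UNIV. \<Sum>k\<in>UNIV. tr (\<iota> (B j k) * u j * frob l (u k) * x * frob l y))"
    by (rule sum.swap)
  finally show ?thesis
    by (simp add: twisted_form_def sum_distrib_right tr_sum)
qed

lemma bilinear_form_expansion:
  assumes "bilinear_form \<iota> S" and dual: "dual_bases u w"
  shows "S x y = twisted_form (form_coeff u w S) x y"
proof -
  have "S x y = S (\<Sum>j\<in>UNIV. \<iota> (tr (x * u j)) * w j) (\<Sum>k\<in>UNIV. \<iota> (tr (y * u k)) * w k)"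
    using dual by (simp add: dual_bases_def)
  also have "\<dots> = (\<Sum>j\<in>UNIV. \<Sum>k\<in>UNIV. S (w j) (w k) * tr (x * u j) * tr (y * u k))"
    by (rule bilinear_form_sum) fact
  finally show ?thesis
    by (simp add: tr_products_twisted_form form_coeff_def[abs_def])
qed

text \<open>Uniqueness of the expansion: the form determines its coefficients below
  \<open>m\<close>.\<close>

lemma form_coeff_twisted_form:
  assumes dual: "dual_bases u w" and "i < m"
  shows "form_coeff u w (twisted_form h) i = h i"
proof -
  have "form_coeff u w (twisted_form h) i =
      (\<Sum>j\<in>UNIV. \<Sum>k\<in>UNIV. \<Sum>l<m. \<iota> (tr (h l * frob l (w k) * w j)) * u j * frob i (u k))"
    unfolding form_coeff_def twisted_form_def iota_sum sum_distrib_right by (simp add: mult_ac)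
  also have "\<dots> = (\<Sum>j\<in>UNIV. \<Sum>l<m. \<Sum>k\<in>UNIV. \<iota> (tr (h l * frob l (w k) * w j)) * u j * frob i (u k))"
    by (simp add: sum.swap[of _ "{..<m}"])
  also have "\<dots> = (\<Sum>l<m. \<Sum>j\<in>UNIV. \<Sum>k\<in>UNIV. \<iota> (tr (h l * frob l (w k) * w j)) * u j * frob i (u k))"
    by (rule sum.swap)
  also have "\<dots> = (\<Sum>l<m. \<Sum>k\<in>UNIV. (\<Sum>j\<in>UNIV. \<iota> (tr (h l * frob l (w k) * w j)) * u j) * frob i (u k))"
    unfolding sum_distrib_right by (intro sum.cong refl sum.swap)
  \<comment> \<open>The inner sum is the expansion of \<open>h l * frob l (w k)\<close> in the basis
    \<open>u\<close>.\<close>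
  also have "\<dots> = (\<Sum>l<m. \<Sum>k\<in>UNIV. h l * frob l (w k) * frob i (u k))"
    using dual by (simp add: dual_bases_def)
  also have "\<dots> = (\<Sum>l<m. h l * (\<Sum>k\<in>UNIV. frob l (w k) * frob i (u k)))"
    by (simp add: sum_distrib_left mult.assoc)
  also have "\<dots> = (\<Sum>l<m. h l * (if l = i then 1 else 0))"
    using dual \<open>i < m\<close> by (simp add: dual_bases_frob)
  also have "\<dots> = h i"
    using \<open>i < m\<close> by (simp add: if_distrib cong: if_cong)
  finally show ?thesis .
qed

text \<open>Applying \<open>frob l\<close> turns \<open>frob (m - l)\<close> into the identity,
  which exchanges the roles of the two basis indices.\<close>

lemma form_coeff_symmetric:
  assumes "symmetric_bilinear_form \<iota> S" "l \<le> m"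
  shows "frob l (form_coeff u w S (m - l)) = form_coeff u w S l"
proof -
  have sym: "S x y = S y x" for x y
    using assms by (simp add: symmetric_bilinear_form_def)
  have "frob l (form_coeff u w S (m - l)) =
      (\<Sum>j\<in>UNIV. \<Sum>k\<in>UNIV. \<iota> (S (w j) (w k)) * frob l (u j) * u k)"
    using assms(2) by (simp add: form_coeff_def frob_sum frob_mult frob_frob)
  also have "\<dots> = form_coeff u w S l"
    unfolding form_coeff_def by (subst sum.swap) (simp add: sym mult_ac)
  finally show ?thesis .
qed

section \<open>Folded coefficients\<close>

text \<open>The index \<open>l\<close> is folded with \<open>m - l\<close>, so that both parities of \<open>m\<close> are treated at once: the
  coefficients are indexed by \<open>2 * l \<le> m\<close>, and the one with \<open>2 * l = m\<close>, if any, lies in the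
  subfield of degree \<open>m div 2\<close>.\<close>

definition half_coeffs :: "(nat \<Rightarrow> 'a) set" where
  "half_coeffs = {f \<in> extensional {l. 2 * l \<le> m}.
     even m \<longrightarrow> frob (m div 2) (f (m div 2)) = f (m div 2)}"

definition half_quad :: "(nat \<Rightarrow> 'a) \<Rightarrow> 'a \<Rightarrow> 'q" where
  "half_quad f x = (\<Sum>l | 2 * l < m. tr (f l * (x * frob l x))) +
     (if even m then rel_trace \<iota> (m div 2) (f (m div 2) * (x * frob (m div 2) x)) else 0)"

definition half_bil :: "(nat \<Rightarrow> 'a) \<Rightarrow> 'a \<Rightarrow> 'a \<Rightarrow> 'q" where
  "half_bil g x y = tr (g 0 * x * y) +
     (\<Sum>l | 0 < l \<and> 2 * l < m. tr (g l * (x * frob l y + frob l x * y))) +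
     (if even m then tr (g (m div 2) * x * frob (m div 2) y) else 0)"

definition half_pairing :: "(nat \<Rightarrow> 'a) \<Rightarrow> (nat \<Rightarrow> 'a) \<Rightarrow> 'q" where
  "half_pairing f g = (\<Sum>l | 2 * l < m. tr (f l * g l)) +
     (if even m then rel_trace \<iota> (m div 2) (f (m div 2) * g (m div 2)) else 0)"

text \<open>The upper half of the coefficients is forced by the relation between \<open>l\<close>
  and \<open>m - l\<close> that symmetric forms satisfy.\<close>

definition unfold_coeffs :: "(nat \<Rightarrow> 'a) \<Rightarrow> nat \<Rightarrow> 'a" where
  "unfold_coeffs g l = (if 2 * l \<le> m then g l else frob l (g (m - l)))"

lemma half_coeffsI:
  assumes "\<And>l. m < 2 * l \<Longrightarrow> f l = undefined"
    and "\<And>n. m = 2 * n \<Longrightarrow> frob n (f n) = f n"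
  shows "f \<in> half_coeffs"
  using assms by (auto simp: half_coeffs_def extensional_def not_le elim!: evenE)

lemma half_coeffs_eqI:
  assumes "f \<in> half_coeffs" "g \<in> half_coeffs" "\<And>l. 2 * l \<le> m \<Longrightarrow> f l = g l"
  shows "f = g"
  by (rule extensionalityI[where A = "{l. 2 * l \<le> m}"]) (use assms in \<open>auto simp: half_coeffs_def\<close>)

lemma half_coeffs_middle:
  assumes "f \<in> half_coeffs" "m = 2 * n"
  shows "frob n (f n) = f n"
  using assms(1) unfolding half_coeffs_def by (simp add: assms(2))

text \<open>Here \<open>frob n\<close> is an involution and swaps the two summands.\<close>

lemma frob_trace_twice:
  assumes "m = 2 * n"
  shows "frob n (y + frob n y) = y + frob n y"
proof -
  have "frob n (frob n y) = y"
    using frob_degree[of y] assms by (simp add: frob_frob flip: mult_2)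
  then show ?thesis
    by (simp add: frob_add)
qed

text \<open>Transitivity of the trace through the middle subfield: the Frobenius powers from
  \<open>n\<close> on are those below \<open>n\<close> applied to \<open>frob n y\<close>.\<close>

lemma tr_eq_rel_trace:
  assumes "m = 2 * n"
  shows "tr y = rel_trace \<iota> n (y + frob n y)"
proof -
  have "(\<Sum>i<2 * n. frob i y) = (\<Sum>i<n. frob i y) + (\<Sum>i<n. frob i (frob n y))"
    using sum.atLeastLessThan_concat[of 0 n "2 * n" "\<lambda>i. frob i y"]
      sum.shift_bounds_nat_ivl[of "\<lambda>i. frob i y" 0 n n]
    by (simp add: frob_frob lessThan_atLeast0 flip: mult_2)
  then have "\<iota> (tr y) = (\<Sum>i<n. frob i (y + frob n y))"
    by (simp add: iota_tr frob_add sum.distrib flip: assms)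
  also have "\<dots> = \<iota> (rel_trace \<iota> n (y + frob n y))"
    using assms by (simp add: iota_rel_trace frob_trace_twice)
  finally show ?thesis
    by (simp add: iota_eq_iff)
qed

text \<open>The map \<open>\<alpha> \<mapsto> \<alpha> + frob n \<alpha>\<close> is linear over its image field and not identically zero.\<close>
lemma trace_to_middle_surj:
  assumes "m = 2 * n" and c: "frob n c = c"
  obtains \<alpha> where "\<alpha> + frob n \<alpha> = c"
proof -
  \<comment> \<open>By transitivity, an element with nonzero \<open>tr\<close> has a nonzero trace
    \<open>?d\<close> to the middle subfield; rescaling it by \<open>c * inverse ?d\<close> then
    yields \<open>c\<close>.\<close>
  obtain x where "tr x \<noteq> 0"
    using tr_nondegenerate[of 1] by auto
  then have nz: "x + frob n x \<noteq> 0" (is "?d \<noteq> 0")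
    using tr_eq_rel_trace[OF assms(1), of x] iota_rel_trace[of n 0] by auto
  have "frob n (c * inverse ?d) = c * inverse ?d"
  proof -
    have "frob n ?d = ?d"
      using assms(1) by (rule frob_trace_twice)
    then show ?thesis
      by (simp only: frob_mult frob_inverse c)
  qed
  then have "c * inverse ?d * x + frob n (c * inverse ?d * x) = c * inverse ?d * ?d"
    by (simp only: frob_mult distrib_left)
  also have "\<dots> = c"
    using nz by simp
  finally show thesis
    by (rule that)
qed

lemma rel_trace_0 [simp]: "rel_trace \<iota> n 0 = 0"
  using iota_rel_trace[of n 0] by simp

text \<open>The term at \<open>m - l\<close> becomes the second half of the symmetrized term at
  \<open>l\<close> once \<open>frob l\<close> is applied inside the trace.\<close>

lemma half_bil_eq_twisted_form: "half_bil g x y = twisted_form (unfold_coeffs g) x y"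
proof -
  let ?F = "\<lambda>l. tr (unfold_coeffs g l * x * frob l y)"
  have "?F l + ?F (m - l) = tr (g l * (x * frob l y + frob l x * y))" if "0 < l" "2 * l < m" for l
  proof -
    have "\<not> 2 * (m - l) \<le> m" "m - (m - l) = l"
      using that by auto
    then have "?F (m - l) = tr (frob (m - l) (g l) * x * frob (m - l) y)"
      by (simp add: unfold_coeffs_def)
    also have "\<dots> = tr (frob l (frob (m - l) (g l) * x * frob (m - l) y))"
      by (simp only: tr_frob)
    also have "\<dots> = tr (g l * frob l x * y)"
      using that by (simp add: frob_mult frob_frob)
    finally show ?thesis
      using that by (simp add: unfold_coeffs_def distrib_left tr_add mult.assoc)
  qed
  moreover have "unfold_coeffs g (m div 2) = g (m div 2)" "unfold_coeffs g 0 = g 0"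
    by (simp_all add: unfold_coeffs_def)
  ultimately show ?thesis
    by (simp add: twisted_form_def half_bil_def sum_fold_half[OF degree_pos])
qed

section \<open>Unique coefficients of symmetric bilinear forms\<close>

text \<open>Only the middle term is not visibly symmetric; there \<open>frob n\<close> fixes the
  coefficient and exchanges \<open>x\<close> with \<open>y\<close> under the trace.\<close>

lemma symmetric_half_bil:
  assumes "g \<in> half_coeffs"
  shows "symmetric_bilinear_form \<iota> (half_bil g)"
proof -
  have "tr (g n * x * frob n y) = tr (g n * y * frob n x)" if n: "m = 2 * n" for n x y
  proof -
    have "tr (g n * x * frob n y) = tr (frob n (g n * x * frob n y))"
      by (simp only: tr_frob)
    also have "\<dots> = tr (g n * y * frob n x)"
      using half_coeffs_middle[OF assms n] frob_degree[of y] n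
      by (simp add: frob_mult frob_frob mult_ac flip: mult_2)
    finally show ?thesis .
  qed
  then have "half_bil g x y = half_bil g y x" for x y
    by (auto simp: half_bil_def mult_ac add_ac elim!: evenE)
  moreover have "half_bil g = twisted_form (unfold_coeffs g)"
    by (simp add: fun_eq_iff half_bil_eq_twisted_form)
  ultimately show ?thesis
    using bilinear_twisted_form by (simp add: symmetric_bilinear_form_def)
qed

lemma symmetric_form_unique_coeffs:
  assumes S: "symmetric_bilinear_form \<iota> S" and dual: "dual_bases u w"
  shows "\<exists>!g. g \<in> half_coeffs \<and> (\<forall>x y. S x y = half_bil g x y)"
proof (rule ex1I)
  let ?h = "form_coeff u w S"
  let ?g = "restrict ?h {l. 2 * l \<le> m}"
  have "?g \<in> half_coeffs"
  proof (rule half_coeffsI)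
    fix n assume "m = 2 * n"
    then show "frob n (?g n) = ?g n"
      using form_coeff_symmetric[OF S, of n u w] by simp
  qed auto
  \<comment> \<open>Symmetry recovers the upper coefficients that the restriction discarded.\<close>
  moreover have "unfold_coeffs ?g l = ?h l" if "l < m" for l
    using that form_coeff_symmetric[OF S, of l u w] by (auto simp: unfold_coeffs_def)
  then have "half_bil ?g x y = S x y" for x y
    using bilinear_form_expansion[OF _ dual, of S x y] S
    by (simp add: half_bil_eq_twisted_form twisted_form_def symmetric_bilinear_form_def)
  ultimately show "?g \<in> half_coeffs \<and> (\<forall>x y. S x y = half_bil ?g x y)"
    by simp
  fix g assume g: "g \<in> half_coeffs \<and> (\<forall>x y. S x y = half_bil g x y)"
  then have "S = twisted_form (unfold_coeffs g)"
    by (simp add: fun_eq_iff half_bil_eq_twisted_form)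
  then have "?h l = unfold_coeffs g l" if "l < m" for l
    using form_coeff_twisted_form[OF dual that] by simp
  then show "g = ?g"
    using g \<open>?g \<in> half_coeffs\<close> degree_pos
    by (intro half_coeffs_eqI) (auto simp: unfold_coeffs_def)
qed

section \<open>Quadratic forms and the pairing of coefficients\<close>

text \<open>A preimage \<alpha> of the middle coefficient under the trace to the middle subfield
  turns the short trace into \<open>tr\<close>. The same \<open>a\<close> must serve the form and
  the pairing.\<close>

lemma half_quad_eq_twisted_form:
  assumes f: "f \<in> half_coeffs"
  obtains a where "\<And>x. half_quad f x = twisted_form a x x"
    and "\<And>g. g \<in> half_coeffs \<Longrightarrow> (\<Sum>l<m. tr (a l * unfold_coeffs g l)) = half_pairing f g"
proof -
  have "\<exists>\<alpha>. \<forall>n. m = 2 * n \<longrightarrow> \<alpha> + frob n \<alpha> = f n"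
  proof (cases "even m")
    case True
    then obtain n where n: "m = 2 * n" ..
    then obtain \<alpha> where "\<alpha> + frob n \<alpha> = f n"
      using half_coeffs_middle[OF f n] by (rule trace_to_middle_surj)
    with n show ?thesis by auto
  qed auto
  then obtain \<alpha> where \<alpha>: "\<And>n. m = 2 * n \<Longrightarrow> \<alpha> + frob n \<alpha> = f n"
    by blast
  \<comment> \<open>The upper half is 0, so folding leaves the lower coefficients unchanged.\<close>
  define a where "a l = (if 2 * l < m then f l else if 2 * l = m then \<alpha> else 0)" for l
  have middle: "tr (\<alpha> * z) = rel_trace \<iota> n (f n * z)" if "m = 2 * n" "frob n z = z" for n z
    unfolding tr_eq_rel_trace[OF that(1)] \<alpha>[OF that(1), symmetric]
    by (simp add: frob_mult distrib_right that(2))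
  \<comment> \<open>Used twice, with \<open>z l = x * frob l x\<close> for the form and with
    \<open>z = unfold_coeffs g\<close> for the pairing.\<close>
  have sum_a: "(\<Sum>l<m. tr (a l * z l)) = (\<Sum>l | 2 * l < m. tr (f l * z l)) +
      (if even m then rel_trace \<iota> (m div 2) (f (m div 2) * z (m div 2)) else 0)"
    if "even m \<Longrightarrow> frob (m div 2) (z (m div 2)) = z (m div 2)" for z
  proof -
    have "a l = f l" "a (m - l) = 0" if "2 * l < m" for l
      using that by (auto simp: a_def)
    moreover have "a (m div 2) = \<alpha>" if "even m"
      using that by (auto simp: a_def)
    ultimately show ?thesis
      using that middle[of "m div 2" "z (m div 2)"] degree_pos
      by (simp add: sum_fold_half sum_half)
  qed
  have "half_quad f x = twisted_form a x x" for x
  proof -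
    have "frob (m div 2) (x * frob (m div 2) x) = x * frob (m div 2) x" if "even m"
      using that frob_degree[of x] by (simp add: frob_mult frob_frob mult.commute flip: mult_2)
    then show ?thesis
      by (simp add: half_quad_def twisted_form_def sum_a mult.assoc)
  qed
  moreover have "(\<Sum>l<m. tr (a l * unfold_coeffs g l)) = half_pairing f g"
    if g: "g \<in> half_coeffs" for g
  proof -
    have "unfold_coeffs g l = g l" if "2 * l \<le> m" for l
      using that by (simp add: unfold_coeffs_def)
    then show ?thesis
      using half_coeffs_middle[OF g] by (simp add: sum_a half_pairing_def)
  qed
  ultimately show thesis
    by (rule that)
qed

lemma represents_twisted_form:
  fixes u :: "'m::finite \<Rightarrow> 'a"
  shows "represents_quadratic \<iota> u (\<lambda>x. twisted_form a x x) (\<chi> j k. twisted_form a (u j) (u k))"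
  by (simp add: represents_quadratic_def ext_scale_def bilinear_form_sum[OF bilinear_twisted_form])

text \<open>The values of \<open>S\<close> are scalars and leave the trace; symmetry of
  \<open>S\<close> absorbs the transposed indices of the matrix product.\<close>

lemma trace_twisted_form:
  fixes u w :: "'m::finite \<Rightarrow> 'a"
  assumes S: "symmetric_bilinear_form \<iota> S"
  shows "trace ((\<chi> j k. twisted_form a (u j) (u k)) ** (\<chi> j k. S (w j) (w k))) =
    (\<Sum>l<m. tr (a l * form_coeff u w S l))"
proof -
  have sym: "S x y = S y x" for x y
    using S by (simp add: symmetric_bilinear_form_def)
  have "tr (a l * form_coeff u w S l) =
      (\<Sum>j\<in>UNIV. \<Sum>k\<in>UNIV. tr (a l * u j * frob l (u k)) * S (w k) (w j))" for l
  proof -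
    have "tr (a l * form_coeff u w S l) =
        (\<Sum>j\<in>UNIV. \<Sum>k\<in>UNIV. tr (\<iota> (S (w j) (w k)) * (a l * u j * frob l (u k))))"
      unfolding form_coeff_def sum_distrib_left tr_sum by (simp add: mult_ac)
    then show ?thesis
      by (simp add: tr_scale mult.commute sym)
  qed
  then have "(\<Sum>l<m. tr (a l * form_coeff u w S l)) =
      (\<Sum>j\<in>UNIV. \<Sum>l<m. \<Sum>k\<in>UNIV. tr (a l * u j * frob l (u k)) * S (w k) (w j))"
    by (simp add: sum.swap[of _ _ "{..<m}"])
  also have "\<dots> = (\<Sum>j\<in>UNIV. \<Sum>k\<in>UNIV. \<Sum>l<m. tr (a l * u j * frob l (u k)) * S (w k) (w j))"
    by (intro sum.cong refl sum.swap)
  finally show ?thesis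
    by (simp add: trace_def matrix_matrix_mult_def twisted_form_def sum_distrib_right)
qed

text \<open>Independence of the choice of \<open>A\<close> allows the matrix of a twisted form, for
  which the trace is a sum over coefficients.\<close>

lemma trace_half_pairing:
  fixes u w :: "'m::finite \<Rightarrow> 'a"
  assumes dual: "dual_bases u w" and f: "f \<in> half_coeffs" and g: "g \<in> half_coeffs"
    and A: "represents_quadratic \<iota> u (half_quad f) A"
  shows "trace (A ** (\<chi> j k. half_bil g (w j) (w k))) = half_pairing f g"
proof -
  obtain a where a: "\<And>x. half_quad f x = twisted_form a x x"
    and pairing: "(\<Sum>l<m. tr (a l * unfold_coeffs g l)) = half_pairing f g"
    using half_quad_eq_twisted_form[OF f] g by metis
  have quad: "half_quad f = (\<lambda>x. twisted_form a x x)"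
    by (simp add: fun_eq_iff a)
  have bil: "half_bil g = twisted_form (unfold_coeffs g)"
    by (simp add: fun_eq_iff half_bil_eq_twisted_form)
  note S = symmetric_half_bil[OF g]
  have "trace (A ** (\<chi> j k. half_bil g (w j) (w k))) =
      trace ((\<chi> j k. twisted_form a (u j) (u k)) ** (\<chi> j k. half_bil g (w j) (w k)))"
    using A[unfolded quad] represents_twisted_form
    by (rule trace_unique_of_represents) (use S in \<open>simp add: symmetric_bilinear_form_def\<close>)
  also have "\<dots> = (\<Sum>l<m. tr (a l * form_coeff u w (half_bil g) l))"
    by (rule trace_twisted_form[OF S])
  also have "\<dots> = (\<Sum>l<m. tr (a l * unfold_coeffs g l))"
    by (simp add: bil form_coeff_twisted_form[OF dual])
  finally show ?thesis
    by (simp only: pairing)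
qed

lemma half_quad_represented:
  fixes u :: "'m::finite \<Rightarrow> 'a"
  assumes "f \<in> half_coeffs"
  shows "\<exists>A. represents_quadratic \<iota> u (half_quad f) A"
proof -
  obtain a where "\<And>x. half_quad f x = twisted_form a x x"
    using half_quad_eq_twisted_form[OF assms] by metis
  then have "half_quad f = (\<lambda>x. twisted_form a x x)"
    by (simp add: fun_eq_iff)
  then show ?thesis
    using represents_twisted_form[of u a] by auto
qed

text \<open>Families supported at one index reduce the claim to nondegeneracy of the trace.\<close>

lemma half_pairing_nondegenerate:
  assumes f: "f \<in> half_coeffs" and f': "f' \<in> half_coeffs"
    and eq: "\<And>g. g \<in> half_coeffs \<Longrightarrow> half_pairing f g = half_pairing f' g"
  shows "f = f'"
proof (rule half_coeffs_eqI[OF f f'])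
  fix l assume l: "2 * l \<le> m"
  \<comment> \<open>The value \<open>undefined\<close> above the middle makes the family
    extensional.\<close>
  let ?g = "\<lambda>c i. if m < 2 * i then undefined else if i = l then c else 0"
  have finite: "finite {i. 2 * i < m}"
    by (rule finite_subset[of _ "{..m}"]) auto
  have "tr (f l * z) = tr (f' l * z)" for z
  proof (cases "2 * l = m")
    case False
    then have g: "?g z \<in> half_coeffs"
      by (intro half_coeffsI) auto
    have single: "half_pairing h (?g z) = tr (h l * z)" for h
    proof -
      have "(\<Sum>i | 2 * i < m. tr (h i * ?g z i)) = (\<Sum>i | 2 * i < m. if i = l then tr (h i * z) else 0)"
        by (rule sum.cong) auto
      then show ?thesis
        using l False finite by (auto simp: half_pairing_def)
    qed
    from eq[OF g] show ?thesis
      by (simp only: single)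
  next
    case True
    \<comment> \<open>A middle coefficient must lie in the subfield, so the trace of
      \<open>z\<close> to it is used; transitivity brings back \<open>tr\<close>.\<close>
    let ?c = "z + frob l z"
    have g: "?g ?c \<in> half_coeffs"
      using True frob_trace_twice[of l z] by (intro half_coeffsI) auto
    have single: "half_pairing h (?g ?c) = tr (h l * z)" if "h \<in> half_coeffs" for h
    proof -
      have "(\<Sum>i | 2 * i < m. tr (h i * ?g ?c i)) = 0"
        using True by (intro sum.neutral) auto
      moreover have "m div 2 = l" "even m"
        using True by auto
      ultimately have "half_pairing h (?g ?c) = rel_trace \<iota> l (h l * ?c)"
        using True by (simp add: half_pairing_def)
      also have "h l * ?c = h l * z + frob l (h l * z)"
        using half_coeffs_middle[OF that, of l] True by (simp add: frob_mult distrib_left)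
      finally show ?thesis
        using True tr_eq_rel_trace[of l] by simp
    qed
    from eq[OF g] show ?thesis
      by (simp only: single[OF f] single[OF f'])
  qed
  then have "tr ((f l - f' l) * z) = 0" for z
    by (simp add: left_diff_distrib tr_diff)
  then show "f l = f' l"
    using tr_nondegenerate by force
qed

section \<open>Unique coefficients of quadratic forms\<close>

text \<open>Vectors are added one at a time, with the polar form giving the mixed terms. The matrix
  is triangular rather than symmetric, which avoids division by 2.\<close>

lemma quadratic_form_sum:
  assumes Q: "quadratic_form \<iota> Q" and "finite F"
  shows "\<exists>A. \<forall>x. Q (\<Sum>i\<in>F. \<iota> (x i) * v i) = (\<Sum>i\<in>F. \<Sum>j\<in>F. A i j * x i * x j)"
  using \<open>finite F\<close>
proof induction
  case empty
  have "Q 0 = 0"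
    using Q[unfolded quadratic_form_def, THEN conjunct1, rule_format, of 0 0]
    by (simp add: ext_scale_def)
  then show ?case by simp
next
  case (insert k F)
  then obtain A where A: "\<And>x. Q (\<Sum>i\<in>F. \<iota> (x i) * v i) = (\<Sum>i\<in>F. \<Sum>j\<in>F. A i j * x i * x j)"
    by blast
  let ?\<beta> = "\<lambda>x y. Q (x + y) - Q x - Q y"
  have \<beta>: "bilinear_form \<iota> ?\<beta>" and scale: "Q (\<iota> c * x) = c ^ 2 * Q x" for c x
    using Q by (simp_all add: quadratic_form_def ext_scale_def)
  \<comment> \<open>The new row carries the mixed terms in full, so the new column is 0 off the
    diagonal.\<close>
  define A' where "A' i j =
    (if i = k then (if j = k then Q (v k) else ?\<beta> (v k) (v j)) else if j = k then 0 else A i j)" for i j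
  have "Q (\<Sum>i\<in>insert k F. \<iota> (x i) * v i) =
      (\<Sum>i\<in>insert k F. \<Sum>j\<in>insert k F. A' i j * x i * x j)" for x
  proof -
    let ?y = "\<Sum>i\<in>F. \<iota> (x i) * v i"
    have "?\<beta> (\<iota> (x k) * v k) ?y = (\<Sum>j\<in>F. A' k j * x k * x j)"
    proof -
      have "?\<beta> (\<iota> (x k) * v k) ?y = (\<Sum>j\<in>F. ?\<beta> (v k) (v j) * x k * x j)"
        using bilinear_form_sum[OF \<beta>, where A = "{k}" and B = F and c = x and d = x and v = v and v' = v]
        by simp
      also have "\<dots> = (\<Sum>j\<in>F. A' k j * x k * x j)"
        using insert by (intro sum.cong) (auto simp: A'_def)
      finally show ?thesis .
    qed
    then have "Q (\<Sum>i\<in>insert k F. \<iota> (x i) * v i) =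
        Q (\<iota> (x k) * v k) + Q ?y + (\<Sum>j\<in>F. A' k j * x k * x j)"
      using insert by (simp add: diff_eq_eq add_ac)
    also have "Q (\<iota> (x k) * v k) = A' k k * x k * x k"
      by (simp add: scale A'_def power2_eq_square)
    also have "Q ?y = (\<Sum>i\<in>F. \<Sum>j\<in>F. A' i j * x i * x j)"
    proof -
      have "A' i j = A i j" if "i \<in> F" "j \<in> F" for i j
        using that insert by (auto simp: A'_def)
      then show ?thesis
        by (simp add: A)
    qed
    finally have "Q (\<Sum>i\<in>insert k F. \<iota> (x i) * v i) = A' k k * x k * x k +
        (\<Sum>i\<in>F. \<Sum>j\<in>F. A' i j * x i * x j) + (\<Sum>j\<in>F. A' k j * x k * x j)" .
    moreover have "(\<Sum>i\<in>F. A' i k * x i * x k) = 0"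
      using insert by (intro sum.neutral) (auto simp: A'_def)
    ultimately show ?thesis
      using insert by (simp add: sum.distrib)
  qed
  then show ?case by blast
qed

lemma quadratic_form_expansion:
  assumes Q: "quadratic_form \<iota> Q" and dual: "dual_bases u w"
  shows "\<exists>a. \<forall>x. Q x = twisted_form a x x"
proof -
  obtain A where A: "\<And>x. Q (\<Sum>i\<in>UNIV. \<iota> (x i) * u i) =
      (\<Sum>i\<in>UNIV. \<Sum>j\<in>UNIV. A i j * x i * x j)"
    using quadratic_form_sum[OF Q, of UNIV u] by auto
  have "Q x = twisted_form (\<lambda>l. \<Sum>j\<in>UNIV. \<Sum>k\<in>UNIV. \<iota> (A j k) * w j * frob l (w k)) x x" for x
    using A[of "\<lambda>i. tr (x * w i)"] dual by (simp add: dual_bases_def tr_products_twisted_form)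
  then show ?thesis by blast
qed

lemma twisted_form_eq_half_quad: "\<exists>f\<in>half_coeffs. \<forall>x. twisted_form a x x = half_quad f x"
proof -
  \<comment> \<open>Index 0 is kept apart because its partner \<open>m\<close> is not a summation
    index; the middle coefficient becomes its trace to the subfield.\<close>
  define f where "f l = (if l = 0 then a 0 else if 2 * l < m then a l + frob l (a (m - l))
    else if 2 * l = m then a l + frob l (a l) else undefined)" for l
  let ?F = "\<lambda>x l. tr (a l * x * frob l x)"
  have "f \<in> half_coeffs"
    using frob_trace_twice degree_pos by (intro half_coeffsI) (auto simp: f_def)
  moreover have "?F x l + ?F x (m - l) = tr (f l * (x * frob l x))" if "0 < l" "2 * l < m" for l x
  proof -
    have "?F x (m - l) = tr (frob l (a (m - l) * x * frob (m - l) x))"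
      by (simp only: tr_frob)
    also have "\<dots> = tr (frob l (a (m - l)) * (x * frob l x))"
      using that by (simp add: frob_mult frob_frob mult_ac)
    finally show ?thesis
      using that by (simp add: f_def distrib_right tr_add mult.assoc)
  qed
  moreover have "?F x n = rel_trace \<iota> n (f n * (x * frob n x))" if "m = 2 * n" for n x
  proof -
    have "frob n (frob n x) = x"
      using frob_degree[of x] that by (simp add: frob_frob flip: mult_2)
    moreover have "f n = a n + frob n (a n)"
      using that degree_pos by (auto simp: f_def)
    ultimately have "f n * (x * frob n x) = a n * x * frob n x + frob n (a n * x * frob n x)"
      by (simp add: frob_mult algebra_simps)
    then show ?thesis
      by (simp only: tr_eq_rel_trace[OF that])
  qed
  moreover have "f 0 = a 0"
    by (simp add: f_def)
  ultimately show ?thesis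
    by (intro bexI[of _ f])
      (auto simp: twisted_form_def half_quad_def sum_fold_half[OF degree_pos] sum_half[OF degree_pos]
        mult.assoc elim!: evenE)
qed

text \<open>Two coefficient families of the same form share a representing matrix, hence have the
  same pairing with every \<open>g\<close>, and nondegeneracy identifies them.\<close>

lemma quadratic_form_unique_coeffs:
  fixes u w :: "'m::finite \<Rightarrow> 'a"
  assumes Q: "quadratic_form \<iota> Q" and dual: "dual_bases u w"
  shows "\<exists>!f. f \<in> half_coeffs \<and> (\<forall>x. Q x = half_quad f x)"
proof -
  obtain a where "\<And>x. Q x = twisted_form a x x"
    using quadratic_form_expansion[OF Q dual] by blast
  then obtain f where f: "f \<in> half_coeffs" "\<And>x. Q x = half_quad f x"
    using twisted_form_eq_half_quad[of a] by auto
  moreover have "f' = f" if f': "f' \<in> half_coeffs" "\<And>x. Q x = half_quad f' x" for f'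
  proof (rule half_pairing_nondegenerate[OF f'(1) f(1)])
    fix g assume g: "g \<in> half_coeffs"
    have eq: "half_quad f' = half_quad f"
      using f(2) f'(2) by (simp add: fun_eq_iff)
    obtain A where A: "represents_quadratic \<iota> u (half_quad f) A"
      using half_quad_represented[OF f(1)] by blast
    show "half_pairing f' g = half_pairing f g"
      using trace_half_pairing[OF dual f'(1) g] trace_half_pairing[OF dual f(1) g A] A eq by metis
  qed
  ultimately show ?thesis by blast
qed

section \<open>The pairing and the two parities of the degree\<close>

lemma pairing_half:
  fixes u w :: "'m::finite \<Rightarrow> 'a"
  assumes dual: "dual_bases u w" and f: "f \<in> half_coeffs" and g: "g \<in> half_coeffs"
  shows "pairing \<iota> \<psi> u w (half_quad f) (half_bil g) = \<psi> (half_pairing f g)"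
proof -
  have "represents_quadratic \<iota> u (half_quad f) (SOME A. represents_quadratic \<iota> u (half_quad f) A)"
    using half_quad_represented[OF f] by (rule someI_ex)
  then show ?thesis
    unfolding pairing_def Let_def by (simp add: trace_half_pairing[OF dual f g])
qed

text \<open>Both parities at once: one pair of dual bases works for all forms.\<close>

lemma half_representation:
  assumes "CARD('m::finite) = m"
  shows
    "(\<forall>Q. quadratic_form \<iota> Q \<longrightarrow> (\<exists>!f. f \<in> half_coeffs \<and> (\<forall>x. Q x = half_quad f x))) \<and>
     (\<forall>S. symmetric_bilinear_form \<iota> S \<longrightarrow>
        (\<exists>!g. g \<in> half_coeffs \<and> (\<forall>x y. S x y = half_bil g x y))) \<and>
     (\<exists>(u :: 'm \<Rightarrow> 'a) (w :: 'm \<Rightarrow> 'a). is_basis \<iota> u \<and> is_basis \<iota> w \<and>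
        (\<forall>Q S. quadratic_form \<iota> Q \<and> symmetric_bilinear_form \<iota> S \<longrightarrow>
           (\<forall>f\<in>half_coeffs. \<forall>g\<in>half_coeffs.
              (\<forall>x. Q x = half_quad f x) \<and> (\<forall>x y. S x y = half_bil g x y) \<longrightarrow>
              pairing \<iota> \<psi> u w Q S = \<psi> (half_pairing f g))))"
proof -
  obtain u w :: "'m \<Rightarrow> 'a" where dual: "dual_bases u w"
    using dual_bases_exist[OF assms] .
  have "pairing \<iota> \<psi> u w Q S = \<psi> (half_pairing f g)"
    if "f \<in> half_coeffs" "g \<in> half_coeffs" "\<forall>x. Q x = half_quad f x" "\<forall>x y. S x y = half_bil g x y"
    for Q S f g
  proof -
    have "Q = half_quad f" "S = half_bil g"
      using that by (simp_all add: fun_eq_iff)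
    then show ?thesis
      using that pairing_half[OF dual] by simp
  qed
  then have pairing: "\<forall>Q S. quadratic_form \<iota> Q \<and> symmetric_bilinear_form \<iota> S \<longrightarrow>
      (\<forall>f\<in>half_coeffs. \<forall>g\<in>half_coeffs.
         (\<forall>x. Q x = half_quad f x) \<and> (\<forall>x y. S x y = half_bil g x y) \<longrightarrow>
         pairing \<iota> \<psi> u w Q S = \<psi> (half_pairing f g))"
    by simp
  have quad: "\<exists>!f. f \<in> half_coeffs \<and> (\<forall>x. Q x = half_quad f x)" if "quadratic_form \<iota> Q" for Q
    using that dual by (rule quadratic_form_unique_coeffs)
  have bil: "\<exists>!g. g \<in> half_coeffs \<and> (\<forall>x y. S x y = half_bil g x y)"
    if "symmetric_bilinear_form \<iota> S" for S
    using that dual by (rule symmetric_form_unique_coeffs)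
  from pairing is_basis_dual_bases[OF dual] is_basis_dual_bases[OF dual_bases_commute[OF dual]]
  show ?thesis
    by (intro conjI exI[of _ u] exI[of _ w]) (assumption | (intro allI impI quad bil; assumption))+
qed

lemma half_coeffs_odd:
  assumes "m = 2 * n - 1"
  shows "half_coeffs = coeffs_odd n"
proof -
  \<comment> \<open>Since subtraction on \<open>nat\<close> truncates, positivity of the degree is
    what rules out \<open>n = 0\<close>.\<close>
  have "{l. 2 * l \<le> m} = {..<n}" "odd m"
    using assms degree_pos by auto
  then show ?thesis
    by (simp add: half_coeffs_def coeffs_odd_def)
qed

lemma half_forms_odd:
  assumes m: "m = 2 * n - 1"
  shows "half_quad f x = quad_odd \<iota> n f x"
    and "half_bil g x y = bil_odd \<iota> n g x y"
    and "half_pairing f g = (\<Sum>i<n. rel_trace \<iota> (2 * n - 1) (f i * g i))"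
proof -
  have "{l. 2 * l < m} = {..<n}" "{l. 0 < l \<and> 2 * l < m} = {1..<n}" "odd m"
    using m degree_pos by auto
  then show "half_quad f x = quad_odd \<iota> n f x" "half_bil g x y = bil_odd \<iota> n g x y"
    "half_pairing f g = (\<Sum>i<n. rel_trace \<iota> (2 * n - 1) (f i * g i))"
    unfolding half_quad_def half_bil_def half_pairing_def quad_odd_def bil_odd_def m[symmetric]
    by (simp_all add: frob_def)
qed

lemma half_coeffs_even:
  assumes "m = 2 * n"
  shows "half_coeffs = coeffs_even \<iota> n"
proof -
  have "{l. 2 * l \<le> m} = {..n}"
    using assms by auto
  then show ?thesis
    unfolding half_coeffs_def by (simp add: coeffs_even_def mid_field_def frob_def assms)
qed

lemma half_forms_even:
  assumes m: "m = 2 * n"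
  shows "half_quad f x = quad_even \<iota> n f x"
    and "half_bil g x y = bil_even \<iota> n g x y"
    and "half_pairing f g = (\<Sum>i<n. rel_trace \<iota> (2 * n) (f i * g i)) + rel_trace \<iota> n (f n * g n)"
proof -
  have "{l. 2 * l < m} = {..<n}" "{l. 0 < l \<and> 2 * l < m} = {1..<n}" "even m" "m div 2 = n"
    using m by auto
  then show "half_quad f x = quad_even \<iota> n f x" "half_bil g x y = bil_even \<iota> n g x y"
    "half_pairing f g = (\<Sum>i<n. rel_trace \<iota> (2 * n) (f i * g i)) + rel_trace \<iota> n (f n * g n)"
    by (simp_all add: half_quad_def half_bil_def half_pairing_def quad_even_def bil_even_def frob_def flip: m)
qed

end

theorem theorem5p1:
  fixes \<iota> :: "'q::{field,finite} \<Rightarrow> 'a::{field,finite}"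
    and \<psi> :: "'q \<Rightarrow> complex"
  assumes "field_embedding \<iota>"
    and "CARD('a) = CARD('q) ^ CARD('m::finite)"
    and "nontrivial_additive_character \<psi>"
  shows
    "(\<forall>n. CARD('m) = 2 * n - 1 \<longrightarrow>
        (\<forall>Q. quadratic_form \<iota> Q \<longrightarrow>
           (\<exists>!f. f \<in> coeffs_odd n \<and> (\<forall>x. Q x = quad_odd \<iota> n f x))) \<and>
        (\<forall>S. symmetric_bilinear_form \<iota> S \<longrightarrow>
           (\<exists>!g. g \<in> coeffs_odd n \<and> (\<forall>x y. S x y = bil_odd \<iota> n g x y))) \<and>
        (\<exists>(u :: 'm \<Rightarrow> 'a) (w :: 'm \<Rightarrow> 'a). is_basis \<iota> u \<and> is_basis \<iota> w \<and>
           (\<forall>Q S. quadratic_form \<iota> Q \<and> symmetric_bilinear_form \<iota> S \<longrightarrow>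
              (\<forall>f\<in>coeffs_odd n. \<forall>g\<in>coeffs_odd n.
                 (\<forall>x. Q x = quad_odd \<iota> n f x) \<and> (\<forall>x y. S x y = bil_odd \<iota> n g x y) \<longrightarrow>
                 pairing \<iota> \<psi> u w Q S =
                   \<psi> (\<Sum>i<n. rel_trace \<iota> (2 * n - 1) (f i * g i)))))) \<and>
     (\<forall>n. CARD('m) = 2 * n \<longrightarrow>
        (\<forall>Q. quadratic_form \<iota> Q \<longrightarrow>
           (\<exists>!f. f \<in> coeffs_even \<iota> n \<and> (\<forall>x. Q x = quad_even \<iota> n f x))) \<and>
        (\<forall>S. symmetric_bilinear_form \<iota> S \<longrightarrow>
           (\<exists>!g. g \<in> coeffs_even \<iota> n \<and> (\<forall>x y. S x y = bil_even \<iota> n g x y))) \<and>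
        (\<exists>(u :: 'm \<Rightarrow> 'a) (w :: 'm \<Rightarrow> 'a). is_basis \<iota> u \<and> is_basis \<iota> w \<and>
           (\<forall>Q S. quadratic_form \<iota> Q \<and> symmetric_bilinear_form \<iota> S \<longrightarrow>
              (\<forall>f\<in>coeffs_even \<iota> n. \<forall>g\<in>coeffs_even \<iota> n.
                 (\<forall>x. Q x = quad_even \<iota> n f x) \<and> (\<forall>x y. S x y = bil_even \<iota> n g x y) \<longrightarrow>
                 pairing \<iota> \<psi> u w Q S =
                   \<psi> ((\<Sum>i<n. rel_trace \<iota> (2 * n) (f i * g i)) +
                      rel_trace \<iota> n (f n * g n))))))"
proof -
  interpret E: finite_field_extension \<iota> "CARD('m)"
    using assms(1,2) by unfold_locales simp_all
  note main = E.half_representation[where 'm = 'm and \<psi> = \<psi>, OF refl]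
  show ?thesis
  proof ((rule conjI; intro allI impI), goal_cases)
    case (1 n)
    show ?case
      using main unfolding E.half_coeffs_odd[OF 1] E.half_forms_odd[OF 1] .
  next
    case (2 n)
    show ?case
      using main unfolding E.half_coeffs_even[OF 2] E.half_forms_even[OF 2] .
  qed
qed

end
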